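(* Let $\Sigma=\{\sigma_1,\sigma_2\}$ be the signature of two binary operation symbols, let $0<\varepsilon<1$, and let $\mathcal V$ be the variety of quantitative $\Sigma$-algebras (on metric spaces) presented by the single quantitative equation $\sigma_1(x,y)=_\varepsilon\sigma_2(x,y)$. Then the free-algebra functor $T_{\mathcal V}:\mathbf{Met}\to\mathbf{Met}$ is not strongly finitary.
   Context: $\mathbf{Met}$ is the category of extended metric spaces (distance $\infty$ allowed) and nonexpanding maps, enriched over itself via the supremum metric on hom-sets (tensor product: cartesian product with the sum metric). An endofunctor $F$ is enriched iff $d(Ff,Fg)\le d(f,g)$ for all parallel pairs. A quantitative $\Sigma$-algebra is a metric space $A$ with operations $\sigma_A:A^n\to A$ nonexpanding with respect to the maximum metric on $A^n$; morphisms are nonexpanding homomorphisms. Here $\mathcal V$ consists of the quantitative algebras with two nonexpanding binary operations satisfying $d(\sigma_1(a,b),\sigma_2(a,b))\le\varepsilon$ for all elements $a,b$. $T_{\mathcal V}$ is the underlying (enriched) endofunctor of the monad of free algebras, i.e. $T_{\mathcal V}=U_{\mathcal V}F_{\mathcal V}$ where $F_{\mathcal V}$ is left adjoint to the forgetful functor $U_{\mathcal V}:\mathcal V\to\mathbf{Met}$. Let $K:\mathbf{Set}_f\to\mathbf{Met}$ be the full embedding of finite sets as finite discrete spaces (all nonzero distances $\infty$). An enriched endofunctor $T$ on $\mathbf{Met}$ is strongly finitary if it is the ($\mathbf{Met}$-enriched) left Kan extension along $K$ of its restriction: $T=\mathrm{Lan}_K(TK)$. *)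

theory Defs
  imports
    "HOL-Library.FuncSet"
    "HOL-Library.Extended_Nonnegative_Real"
    "HOL-Library.Infinite_Typeclass"
begin

section \<open>The category of extended metric spaces\<close>

text \<open>
  Objects of Met are the extended metric spaces whose points are taken from a fixed infinite type,
  which plays the role of the universe.  Every infinite type is large enough for all constructions
  below: the free algebras over a space and the colimit defining the left Kan extension have at most
  as many points as the type has elements.  Morphisms are extensional functions
  (\<open>undefined\<close> outside the domain), so that equality of morphisms is equality of functions.
  The type of points in \<open>'a met\<close> is arbitrary, as hom-sets are extended metric spaces as well.
\<close>

record 'a met =
  pts :: "'a set"
  dst :: "'a \<Rightarrow> 'a \<Rightarrow> ennreal"

definition is_met :: "'a met \<Rightarrow> bool" where
  "is_met X \<longleftrightarrow>
     (\<forall>x\<in>pts X. \<forall>y\<in>pts X. dst X x y = 0 \<longleftrightarrow> x = y) \<and>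
     (\<forall>x\<in>pts X. \<forall>y\<in>pts X. dst X x y = dst X y x) \<and>
     (\<forall>x\<in>pts X. \<forall>y\<in>pts X. \<forall>z\<in>pts X. dst X x z \<le> dst X x y + dst X y z)"

definition met_hom :: "'a met \<Rightarrow> 'b met \<Rightarrow> ('a \<Rightarrow> 'b) set" where
  "met_hom X Y =
     {f \<in> pts X \<rightarrow>\<^sub>E pts Y. \<forall>x\<in>pts X. \<forall>y\<in>pts X. dst Y (f x) (f y) \<le> dst X x y}"

definition hom_space :: "'a met \<Rightarrow> 'b met \<Rightarrow> ('a \<Rightarrow> 'b) met" where
  "hom_space X Y =
     \<lparr>pts = met_hom X Y, dst = (\<lambda>f g. SUP x\<in>pts X. dst Y (f x) (g x))\<rparr>"

definition isometric_iso :: "'a met \<Rightarrow> 'b met \<Rightarrow> ('a \<Rightarrow> 'b) \<Rightarrow> bool" where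
  "isometric_iso X Y f \<longleftrightarrow>
     bij_betw f (pts X) (pts Y) \<and>
     (\<forall>x\<in>pts X. \<forall>y\<in>pts X. dst Y (f x) (f y) = dst X x y)"

text \<open>
  Action of a Met-valued functor on objects and on arrows; the latter takes the source and target of
  the arrow as arguments.  The type \<open>'o\<close> of objects of the domain is \<open>'a met\<close> for
  endofunctors of Met and \<open>'a set\<close> for functors on finite sets.
\<close>

record ('o, 'a) met_functor =
  ob :: "'o \<Rightarrow> 'a met"
  ar :: "'o \<Rightarrow> 'o \<Rightarrow> ('a \<Rightarrow> 'a) \<Rightarrow> ('a \<Rightarrow> 'a)"

definition enriched_endofunctor :: "('a met, 'a) met_functor \<Rightarrow> bool" where
  "enriched_endofunctor T \<longleftrightarrow>
     (\<forall>X. is_met X \<longrightarrow> is_met (ob T X)) \<and>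
     (\<forall>X Y. is_met X \<longrightarrow> is_met Y \<longrightarrow>
        (\<forall>f\<in>met_hom X Y. ar T X Y f \<in> met_hom (ob T X) (ob T Y)) \<and>
        (\<forall>f\<in>met_hom X Y. \<forall>g\<in>met_hom X Y.
           dst (hom_space (ob T X) (ob T Y)) (ar T X Y f) (ar T X Y g)
             \<le> dst (hom_space X Y) f g)) \<and>
     (\<forall>X. is_met X \<longrightarrow> ar T X X (restrict id (pts X)) = restrict id (pts (ob T X))) \<and>
     (\<forall>X Y Z. is_met X \<longrightarrow> is_met Y \<longrightarrow> is_met Z \<longrightarrow>
        (\<forall>f\<in>met_hom X Y. \<forall>g\<in>met_hom Y Z.
           ar T X Z (compose (pts X) g f)
             = compose (pts (ob T X)) (ar T Y Z g) (ar T X Y f)))"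


section \<open>Strongly finitary functors\<close>

text \<open>
  The category of finite sets is represented by the finite subsets of the universe; its arrows
  \<open>A \<rightarrow> B\<close> are the elements of \<open>A \<rightarrow>\<^sub>E B\<close>.
\<close>

definition discrete_embedding :: "('a set, 'a) met_functor" where
  "discrete_embedding =
     \<lparr>ob = (\<lambda>A. \<lparr>pts = A, dst = (\<lambda>x y. if x = y then 0 else \<infinity>)\<rparr>),
      ar = (\<lambda>A B g. g)\<rparr>"

definition functor_comp ::
    "('b met, 'b) met_functor \<Rightarrow> ('o, 'b) met_functor \<Rightarrow> ('o, 'b) met_functor" where
  "functor_comp T S =
     \<lparr>ob = (\<lambda>A. ob T (ob S A)),
      ar = (\<lambda>A B g. ar T (ob S A) (ob S B) (ar S A B g))\<rparr>"

abbreviation disc :: "'a set \<Rightarrow> 'a met" where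
  "disc \<equiv> ob discrete_embedding"

definition setf_nat_trans ::
    "('a set, 'a) met_functor \<Rightarrow> ('a set, 'a) met_functor \<Rightarrow> ('a set \<Rightarrow> 'a \<Rightarrow> 'a) \<Rightarrow> bool" where
  "setf_nat_trans G H \<eta> \<longleftrightarrow>
     (\<forall>A. finite A \<longrightarrow> \<eta> A \<in> met_hom (ob G A) (ob H A)) \<and>
     (\<forall>A B. finite A \<longrightarrow> finite B \<longrightarrow> (\<forall>g \<in> A \<rightarrow>\<^sub>E B.
        compose (pts (ob G A)) (\<eta> B) (ar G A B g)
          = compose (pts (ob G A)) (ar H A B g) (\<eta> A)))"

text \<open>
  With \<open>K\<close> the discrete embedding, the space \<open>[Set\<^sub>f\<^sup>o\<^sup>p, Met](Met(K-, X), Met(G-, Y))\<close>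
  of enriched natural transformations with the supremum metric.  As the hom-spaces between
  discrete spaces are discrete, enriched naturality is ordinary naturality with nonexpanding components.
\<close>

definition cocone_space ::
    "('a set, 'a) met_functor \<Rightarrow> 'a met \<Rightarrow> 'a met \<Rightarrow> ('a set \<Rightarrow> ('a \<Rightarrow> 'a) \<Rightarrow> 'a \<Rightarrow> 'a) met" where
  "cocone_space G X Y =
     \<lparr>pts = {\<phi> \<in> (\<Pi>\<^sub>E A\<in>Collect finite.
                    met_hom (hom_space (disc A) X) (hom_space (ob G A) Y)).
              \<forall>A B. finite A \<longrightarrow> finite B \<longrightarrow> (\<forall>g \<in> A \<rightarrow>\<^sub>E B. \<forall>u \<in> met_hom (disc B) X.
                \<phi> A (compose A u g) = compose (pts (ob G A)) (\<phi> B u) (ar G A B g))},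
      dst = (\<lambda>\<phi> \<psi>. SUP A\<in>Collect finite.
                dst (hom_space (hom_space (disc A) X) (hom_space (ob G A) Y)) (\<phi> A) (\<psi> A))\<rparr>"

text \<open>
  The unit \<open>\<eta> : G \<rightarrow> LK\<close> exhibits \<open>L\<close> as the (pointwise, enriched) left Kan extension of
  \<open>G\<close> along \<open>K\<close>: for every \<open>X\<close> the object \<open>L X\<close> is the colimit of \<open>G\<close> weighted by
  \<open>Met(K-, X)\<close>, that is, the maps
  \<open>Met(L X, Y) \<rightarrow> [Set\<^sub>f\<^sup>o\<^sup>p, Met](Met(K-, X), Met(G-, Y))\<close> sending
  \<open>f\<close> to \<open>u \<mapsto> f \<circ> L u \<circ> \<eta>\<close> are isomorphisms in Met.
\<close>

definition left_Kan_ext_along_discrete ::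
    "('a set, 'a) met_functor \<Rightarrow> ('a met, 'a) met_functor \<Rightarrow> ('a set \<Rightarrow> 'a \<Rightarrow> 'a) \<Rightarrow> bool" where
  "left_Kan_ext_along_discrete G L \<eta> \<longleftrightarrow>
     setf_nat_trans G (functor_comp L discrete_embedding) \<eta> \<and>
     (\<forall>X Y. is_met X \<longrightarrow> is_met Y \<longrightarrow>
        isometric_iso (hom_space (ob L X) Y) (cocone_space G X Y)
          (\<lambda>f. \<lambda>A\<in>Collect finite. \<lambda>u\<in>met_hom (disc A) X.
             compose (pts (ob G A)) f
               (compose (pts (ob G A)) (ar L (disc A) X u) (\<eta> A))))"

text \<open>
  This notion is meant for \<open>T\<close> satisfying \<^const>\<open>enriched_endofunctor\<close>.  The unit is existentially
  quantified, so \<open>T\<close> is only required to be isomorphic to the left Kan extension of its restriction.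
\<close>

definition strongly_finitary :: "('a met, 'a) met_functor \<Rightarrow> bool" where
  "strongly_finitary T \<longleftrightarrow>
     (\<exists>\<eta>. left_Kan_ext_along_discrete (functor_comp T discrete_embedding) T \<eta>)"


section \<open>Quantitative algebras with two binary operations\<close>

record 'a qalg =
  space :: "'a met"
  op1 :: "'a \<Rightarrow> 'a \<Rightarrow> 'a"
  op2 :: "'a \<Rightarrow> 'a \<Rightarrow> 'a"

definition nonexpanding_op :: "'a met \<Rightarrow> ('a \<Rightarrow> 'a \<Rightarrow> 'a) \<Rightarrow> bool" where
  "nonexpanding_op X f \<longleftrightarrow>
     (\<forall>a\<in>pts X. \<forall>b\<in>pts X. f a b \<in> pts X) \<and>
     (\<forall>a\<in>pts X. \<forall>b\<in>pts X. \<forall>c\<in>pts X. \<forall>d\<in>pts X.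
        dst X (f a b) (f c d) \<le> max (dst X a c) (dst X b d))"

definition is_qalg :: "'a qalg \<Rightarrow> bool" where
  "is_qalg A \<longleftrightarrow> is_met (space A) \<and>
     nonexpanding_op (space A) (op1 A) \<and> nonexpanding_op (space A) (op2 A)"

definition qalg_hom :: "'a qalg \<Rightarrow> 'a qalg \<Rightarrow> ('a \<Rightarrow> 'a) set" where
  "qalg_hom A B =
     {h \<in> met_hom (space A) (space B). \<forall>a\<in>pts (space A). \<forall>b\<in>pts (space A).
        h (op1 A a b) = op1 B (h a) (h b) \<and> h (op2 A a b) = op2 B (h a) (h b)}"

text \<open>
  The variety presented by the quantitative equation \<open>\<sigma>\<^sub>1(x,y) =\<^sub>\<epsilon> \<sigma>\<^sub>2(x,y)\<close>.
\<close>

definition variety :: "real \<Rightarrow> 'a qalg set" where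
  "variety \<epsilon> = {A. is_qalg A \<and>
     (\<forall>a\<in>pts (space A). \<forall>b\<in>pts (space A).
        dst (space A) (op1 A a b) (op2 A a b) \<le> ennreal \<epsilon>)}"

definition free_algebra :: "real \<Rightarrow> 'a met \<Rightarrow> 'a qalg \<Rightarrow> ('a \<Rightarrow> 'a) \<Rightarrow> bool" where
  "free_algebra \<epsilon> X F \<eta> \<longleftrightarrow>
     F \<in> variety \<epsilon> \<and> \<eta> \<in> met_hom X (space F) \<and>
     (\<forall>A\<in>variety \<epsilon>. \<forall>f\<in>met_hom X (space A).
        \<exists>!h. h \<in> qalg_hom F A \<and> compose (pts X) h \<eta> = f)"

text \<open>
  \<open>T = U F\<close>, where \<open>F\<close> is left adjoint to the forgetful functor \<open>U\<close> with unit \<open>\<eta>\<close>.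
\<close>

definition free_algebra_functor :: "real \<Rightarrow> ('a met, 'a) met_functor \<Rightarrow> bool" where
  "free_algebra_functor \<epsilon> T \<longleftrightarrow>
     (\<exists>F \<eta>.
        (\<forall>X. is_met X \<longrightarrow> free_algebra \<epsilon> X (F X) (\<eta> X) \<and> ob T X = space (F X)) \<and>
        (\<forall>X Y. is_met X \<longrightarrow> is_met Y \<longrightarrow> (\<forall>f\<in>met_hom X Y.
           ar T X Y f \<in> qalg_hom (F X) (F Y) \<and>
           compose (pts X) (ar T X Y f) (\<eta> X) = compose (pts X) (\<eta> Y) f)))"


section \<open>Free-algebra functors exist and are enriched\<close>

lemma met_homD:
  assumes "f \<in> met_hom X Y"
  shows "\<And>x. x \<in> pts X \<Longrightarrow> f x \<in> pts Y"
    and "\<And>x. x \<notin> pts X \<Longrightarrow> f x = undefined"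
    and "\<And>x y. x \<in> pts X \<Longrightarrow> y \<in> pts X \<Longrightarrow> dst Y (f x) (f y) \<le> dst X x y"
  using assms by (auto simp: met_hom_def PiE_def extensional_def)

lemma met_homI:
  assumes "\<And>x. x \<in> pts X \<Longrightarrow> f x \<in> pts Y"
    and "\<And>x. x \<notin> pts X \<Longrightarrow> f x = undefined"
    and "\<And>x y. x \<in> pts X \<Longrightarrow> y \<in> pts X \<Longrightarrow> dst Y (f x) (f y) \<le> dst X x y"
  shows "f \<in> met_hom X Y"
  using assms by (auto simp: met_hom_def PiE_def extensional_def)

lemma met_hom_compose:
  assumes "f \<in> met_hom X Y" "g \<in> met_hom Y Z"
  shows "compose (pts X) g f \<in> met_hom X Z"
proof (rule met_homI)
  fix x y assume "x \<in> pts X" "y \<in> pts X"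
  then show "dst Z (compose (pts X) g f x) (compose (pts X) g f y) \<le> dst X x y"
    using order_trans[OF met_homD(3)[OF assms(2)] met_homD(3)[OF assms(1)]] met_homD(1)[OF assms(1)]
    by (simp add: compose_def)
qed (use met_homD[OF assms(1)] met_homD[OF assms(2)] in \<open>auto simp: compose_def\<close>)

lemma met_hom_id: "restrict id (pts X) \<in> met_hom X X"
  by (rule met_homI) auto

lemma qalg_homD:
  assumes "h \<in> qalg_hom A B"
  shows "h \<in> met_hom (space A) (space B)"
    and "\<And>a b. a \<in> pts (space A) \<Longrightarrow> b \<in> pts (space A) \<Longrightarrow> h (op1 A a b) = op1 B (h a) (h b)"
    and "\<And>a b. a \<in> pts (space A) \<Longrightarrow> b \<in> pts (space A) \<Longrightarrow> h (op2 A a b) = op2 B (h a) (h b)"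
  using assms by (auto simp: qalg_hom_def)

lemma qalg_op_closed:
  assumes "is_qalg A" "a \<in> pts (space A)" "b \<in> pts (space A)"
  shows "op1 A a b \<in> pts (space A)" "op2 A a b \<in> pts (space A)"
  using assms by (auto simp: is_qalg_def nonexpanding_op_def)

lemma qalg_hom_compose:
  assumes A: "is_qalg A" and f: "f \<in> qalg_hom A B" and g: "g \<in> qalg_hom B C"
  shows "compose (pts (space A)) g f \<in> qalg_hom A C"
  using met_hom_compose[OF qalg_homD(1)[OF f] qalg_homD(1)[OF g]]
    qalg_homD[OF f] qalg_homD[OF g] qalg_op_closed[OF A] met_homD(1)[OF qalg_homD(1)[OF f]]
  by (auto simp: qalg_hom_def compose_def)

lemma qalg_hom_id: "is_qalg A \<Longrightarrow> restrict id (pts (space A)) \<in> qalg_hom A A"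
  using met_hom_id[of "space A"] qalg_op_closed[of A] by (auto simp: qalg_hom_def)

lemma varietyD: "A \<in> variety \<epsilon> \<Longrightarrow> is_qalg A" "A \<in> variety \<epsilon> \<Longrightarrow> is_met (space A)"
  by (auto simp: variety_def is_qalg_def)

lemma free_algebra_unique:
  assumes "free_algebra \<epsilon> X F \<eta>" "A \<in> variety \<epsilon>"
    "h \<in> qalg_hom F A" "k \<in> qalg_hom F A" "compose (pts X) h \<eta> = compose (pts X) k \<eta>"
  shows "h = k"
proof -
  have "compose (pts X) h \<eta> \<in> met_hom X (space A)"
    using assms(1) met_hom_compose[OF _ qalg_homD(1)[OF assms(3)]]
    unfolding free_algebra_def by blast
  then have "\<exists>!h'. h' \<in> qalg_hom F A \<and> compose (pts X) h' \<eta> = compose (pts X) h \<eta>"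
    using assms(1,2) by (simp add: free_algebra_def)
  then show ?thesis using assms(3-5) by auto
qed

lemma free_algebra_induct:
  assumes fr: "free_algebra \<epsilon> X F \<eta>"
    and S: "S \<subseteq> pts (space F)" "\<And>x. x \<in> pts X \<Longrightarrow> \<eta> x \<in> S"
      "\<And>a b. a \<in> S \<Longrightarrow> b \<in> S \<Longrightarrow> op1 F a b \<in> S" "\<And>a b. a \<in> S \<Longrightarrow> b \<in> S \<Longrightarrow> op2 F a b \<in> S"
  shows "S = pts (space F)"
proof -
  define A where "A = F\<lparr>space := \<lparr>pts = S, dst = dst (space F)\<rparr>\<rparr>"
  have F: "F \<in> variety \<epsilon>" and eta: "\<eta> \<in> met_hom X (space F)"
    using fr by (auto simp: free_algebra_def)
  have "is_met (space A)"
    using varietyD(2)[OF F] S(1) unfolding is_met_def A_def by simp blast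
  moreover have "nonexpanding_op (space A) (op1 A)" "nonexpanding_op (space A) (op2 A)"
    using varietyD(1)[OF F] S unfolding is_qalg_def nonexpanding_op_def A_def
    by (simp_all add: subset_iff)
  ultimately have A: "A \<in> variety \<epsilon>"
    using F S(1) by (auto simp: variety_def is_qalg_def A_def)
  have "\<eta> \<in> met_hom X (space A)"
    using met_homD[OF eta] S(2) by (intro met_homI) (auto simp: A_def)
  then obtain h where h: "h \<in> qalg_hom F A" "compose (pts X) h \<eta> = \<eta>"
    using fr A unfolding free_algebra_def by metis
  have hF: "h \<in> qalg_hom F F"
    using h(1) S(1) by (auto simp: qalg_hom_def A_def met_hom_def PiE_def Pi_def)
  have "compose (pts X) (restrict id (pts (space F))) \<eta> = \<eta>"
    using met_homD[OF eta] by (auto simp: compose_def fun_eq_iff)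
  then have "h = restrict id (pts (space F))"
    using free_algebra_unique[OF fr F hF qalg_hom_id[OF varietyD(1)[OF F]]] h(2) by simp
  then have "x \<in> S" if "x \<in> pts (space F)" for x
    using met_homD(1)[OF qalg_homD(1)[OF h(1)] that] that by (simp add: A_def)
  then show ?thesis using S(1) by blast
qed

theorem free_algebra_functor_enriched:
  assumes "free_algebra_functor \<epsilon> T"
  shows "enriched_endofunctor T"
proof -
  obtain F \<eta> where
      fr: "\<And>X. is_met X \<Longrightarrow> free_algebra \<epsilon> X (F X) (\<eta> X)"
    and obT: "\<And>X. is_met X \<Longrightarrow> ob T X = space (F X)"
    and arT: "\<And>X Y f. is_met X \<Longrightarrow> is_met Y \<Longrightarrow> f \<in> met_hom X Y \<Longrightarrow>
        ar T X Y f \<in> qalg_hom (F X) (F Y)"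
    and nat: "\<And>X Y f. is_met X \<Longrightarrow> is_met Y \<Longrightarrow> f \<in> met_hom X Y \<Longrightarrow>
        compose (pts X) (ar T X Y f) (\<eta> X) = compose (pts X) (\<eta> Y) f"
    using assms unfolding free_algebra_functor_def by blast
  have var: "F X \<in> variety \<epsilon>" and eta: "\<eta> X \<in> met_hom X (space (F X))" if "is_met X" for X
    using fr[OF that] by (auto simp: free_algebra_def)
  have natx: "ar T X Y f (\<eta> X x) = \<eta> Y (f x)"
    if "is_met X" "is_met Y" "f \<in> met_hom X Y" "x \<in> pts X" for X Y f x
    using fun_cong[OF nat[OF that(1-3)], of x] that(4) by (simp add: compose_def)
  have ne: "dst (ob T Y) (ar T X Y f t) (ar T X Y g t) \<le> dst (hom_space X Y) f g"
    if X: "is_met X" and Y: "is_met Y" and f: "f \<in> met_hom X Y" and g: "g \<in> met_hom X Y"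
      and t: "t \<in> pts (ob T X)" for X Y f g t
  proof -
    let ?c = "dst (hom_space X Y) f g"
    define S where "S = {t \<in> pts (space (F X)). dst (space (F Y)) (ar T X Y f t) (ar T X Y g t) \<le> ?c}"
    note hf = arT[OF X Y f] and hg = arT[OF X Y g]
    have "S = pts (space (F X))"
    proof (rule free_algebra_induct[OF fr[OF X]])
      fix x assume x: "x \<in> pts X"
      have "dst (space (F Y)) (\<eta> Y (f x)) (\<eta> Y (g x)) \<le> dst Y (f x) (g x)"
        using met_homD[OF eta[OF Y]] met_homD(1)[OF f x] met_homD(1)[OF g x] by blast
      also have "\<dots> \<le> ?c"
        using x by (auto simp: hom_space_def intro: SUP_upper)
      finally show "\<eta> X x \<in> S"
        using x met_homD(1)[OF eta[OF X]] natx[OF X Y f x] natx[OF X Y g x] by (simp add: S_def)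
    next
      fix a b assume ab: "a \<in> S" "b \<in> S"
      then have mem: "a \<in> pts (space (F X))" "b \<in> pts (space (F X))" by (auto simp: S_def)
      have le: "max (dst (space (F Y)) (ar T X Y f a) (ar T X Y g a))
                    (dst (space (F Y)) (ar T X Y f b) (ar T X Y g b)) \<le> ?c"
        using ab by (simp add: S_def)
      note m = met_homD(1)[OF qalg_homD(1)[OF hf]] met_homD(1)[OF qalg_homD(1)[OF hg]]
      have q: "is_qalg (F Y)" using var[OF Y] varietyD by blast
      have "dst (space (F Y)) (op1 (F Y) (ar T X Y f a) (ar T X Y f b))
              (op1 (F Y) (ar T X Y g a) (ar T X Y g b)) \<le> ?c"
        using q m mem by (intro order_trans[OF _ le]) (simp add: is_qalg_def nonexpanding_op_def)
      then show "op1 (F X) a b \<in> S"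
        using mem qalg_homD(2)[OF hf] qalg_homD(2)[OF hg]
          qalg_op_closed(1)[OF varietyD(1)[OF var[OF X]]]
        by (simp add: S_def)
      have "dst (space (F Y)) (op2 (F Y) (ar T X Y f a) (ar T X Y f b))
              (op2 (F Y) (ar T X Y g a) (ar T X Y g b)) \<le> ?c"
        using q m mem by (intro order_trans[OF _ le]) (simp add: is_qalg_def nonexpanding_op_def)
      then show "op2 (F X) a b \<in> S"
        using mem qalg_homD(3)[OF hf] qalg_homD(3)[OF hg]
          qalg_op_closed(2)[OF varietyD(1)[OF var[OF X]]]
        by (simp add: S_def)
    qed (auto simp: S_def)
    then show ?thesis using t obT[OF X] obT[OF Y] by (auto simp: S_def)
  qed
  show ?thesis
    unfolding enriched_endofunctor_def
  proof (intro conjI allI impI ballI)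
    fix X :: "'a met" assume "is_met X"
    then show "is_met (ob T X)" using obT var varietyD(2) by metis
  next
    fix X Y :: "'a met" and f assume "is_met X" "is_met Y" "f \<in> met_hom X Y"
    then show "ar T X Y f \<in> met_hom (ob T X) (ob T Y)"
      using arT obT qalg_homD(1) by metis
  next
    fix X Y :: "'a met" and f g
    assume "is_met X" "is_met Y" "f \<in> met_hom X Y" "g \<in> met_hom X Y"
    then show "dst (hom_space (ob T X) (ob T Y)) (ar T X Y f) (ar T X Y g) \<le> dst (hom_space X Y) f g"
      using ne by (subst hom_space_def) (simp add: SUP_least)
  next
    fix X :: "'a met" assume X: "is_met X"
    have "compose (pts X) (restrict id (pts (space (F X)))) (\<eta> X) = compose (pts X) (\<eta> X) (restrict id (pts X))"
      using met_homD(1)[OF eta[OF X]] by (auto simp: compose_def fun_eq_iff)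
    then show "ar T X X (restrict id (pts X)) = restrict id (pts (ob T X))"
      using free_algebra_unique[OF fr[OF X] var[OF X] arT[OF X X met_hom_id]
          qalg_hom_id[OF varietyD(1)[OF var[OF X]]]] nat[OF X X met_hom_id] obT[OF X] by simp
  next
    fix X Y Z :: "'a met" and f g
    assume X: "is_met X" and Y: "is_met Y" and Z: "is_met Z"
      and f: "f \<in> met_hom X Y" and g: "g \<in> met_hom Y Z"
    have c: "compose (pts (space (F X))) (ar T Y Z g) (ar T X Y f) \<in> qalg_hom (F X) (F Z)"
      using qalg_hom_compose[OF varietyD(1)[OF var[OF X]] arT[OF X Y f] arT[OF Y Z g]] .
    have "compose (pts X) (compose (pts (space (F X))) (ar T Y Z g) (ar T X Y f)) (\<eta> X)
        = compose (pts X) (\<eta> Z) (compose (pts X) g f)"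
      using natx[OF X Y f] natx[OF Y Z g] met_homD(1)[OF eta[OF X]] met_homD(1)[OF f]
      by (auto simp: compose_def fun_eq_iff)
    then show "ar T X Z (compose (pts X) g f) = compose (pts (ob T X)) (ar T Y Z g) (ar T X Y f)"
      using free_algebra_unique[OF fr[OF X] var[OF Z] arT[OF X Z met_hom_compose[OF f g]] c]
        nat[OF X Z met_hom_compose[OF f g]] obT[OF X] by simp
  qed
qed

text \<open>
  As \<open>\<epsilon> > 0\<close>, distinct terms have positive distance, and the free algebra on a space consists
  of all terms over it; \<open>App True\<close> and \<open>App False\<close> stand for \<open>\<sigma>\<^sub>1\<close> and \<open>\<sigma>\<^sub>2\<close>.
\<close>

datatype 'a tm = Var 'a | App bool "'a tm" "'a tm"

fun tm_dist :: "ennreal \<Rightarrow> ('a \<Rightarrow> 'a \<Rightarrow> ennreal) \<Rightarrow> 'a tm \<Rightarrow> 'a tm \<Rightarrow> ennreal" where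
  "tm_dist e d (Var x) (Var y) = d x y"
| "tm_dist e d (App i s t) (App j s' t') =
     (if i = j then 0 else e) + max (tm_dist e d s s') (tm_dist e d t t')"
| "tm_dist e d (Var x) (App j s' t') = \<infinity>"
| "tm_dist e d (App i s t) (Var y) = \<infinity>"

fun tm_eval :: "'a qalg \<Rightarrow> ('b \<Rightarrow> 'a) \<Rightarrow> 'b tm \<Rightarrow> 'a" where
  "tm_eval A f (Var x) = f x"
| "tm_eval A f (App i s t) = (if i then op1 A else op2 A) (tm_eval A f s) (tm_eval A f t)"

lemma ennreal_max_eq_0: "max a b = 0 \<longleftrightarrow> a = 0 \<and> b = (0::ennreal)"
  by (metis antisym_conv max.cobounded1 max.cobounded2 max.idem zero_le)

lemma tm_dist_eq_0:
  assumes "e > 0" "is_met X" "set_tm s \<subseteq> pts X" "set_tm t \<subseteq> pts X"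
  shows "tm_dist e (dst X) s t = 0 \<longleftrightarrow> s = t"
  using assms(3,4)
proof (induction s arbitrary: t)
  case (Var x)
  then show ?case using assms(2) by (cases t) (auto simp: is_met_def)
next
  case (App i s1 s2)
  then show ?case
    using assms(1) by (cases t) (auto simp: ennreal_max_eq_0)
qed

lemma tm_dist_sym:
  assumes "is_met X" "set_tm s \<subseteq> pts X" "set_tm t \<subseteq> pts X"
  shows "tm_dist e (dst X) s t = tm_dist e (dst X) t s"
  using assms(2,3)
proof (induction s arbitrary: t)
  case (Var x)
  then show ?case using assms(1) by (cases t) (auto simp: is_met_def)
next
  case (App i s1 s2)
  then show ?case by (cases t) auto
qed

lemma max_add_le:
  fixes a b c a' b' c' :: ennreal
  assumes "a \<le> b + c" "a' \<le> b' + c'"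
  shows "max a a' \<le> max b b' + max c c'"
  using order_trans[OF assms(1) add_mono[OF max.cobounded1 max.cobounded1]]
    order_trans[OF assms(2) add_mono[OF max.cobounded2 max.cobounded2]] by simp

lemma tm_dist_triangle:
  assumes "is_met X" "set_tm s \<subseteq> pts X" "set_tm t \<subseteq> pts X" "set_tm u \<subseteq> pts X"
  shows "tm_dist e (dst X) s u \<le> tm_dist e (dst X) s t + tm_dist e (dst X) t u"
  using assms(2-4)
proof (induction s arbitrary: t u)
  case (Var x)
  then show ?case using assms(1) by (cases t; cases u) (auto simp: is_met_def)
next
  case (App i s1 s2)
  show ?case
  proof (cases "\<exists>j t1 t2 k u1 u2. t = App j t1 t2 \<and> u = App k u1 u2")
    case True
    then obtain j t1 t2 k u1 u2 where tu: "t = App j t1 t2" "u = App k u1 u2" by blast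
    have "max (tm_dist e (dst X) s1 u1) (tm_dist e (dst X) s2 u2) \<le>
        max (tm_dist e (dst X) s1 t1) (tm_dist e (dst X) s2 t2) +
        max (tm_dist e (dst X) t1 u1) (tm_dist e (dst X) t2 u2)"
      using App tu by (intro max_add_le) auto
    then have "(if i = k then 0 else e) + max (tm_dist e (dst X) s1 u1) (tm_dist e (dst X) s2 u2) \<le>
        ((if i = j then 0 else e) + (if j = k then 0 else e)) +
        (max (tm_dist e (dst X) s1 t1) (tm_dist e (dst X) s2 t2) +
         max (tm_dist e (dst X) t1 u1) (tm_dist e (dst X) t2 u2))"
      by (intro add_mono) auto
    then show ?thesis
      unfolding tu tm_dist.simps by (simp only: ac_simps)
  next
    case False
    then show ?thesis by (cases t; cases u) auto
  qed
qed

lemma tm_eval_closed: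
  assumes "is_qalg A" "f \<in> met_hom X (space A)" "set_tm t \<subseteq> pts X"
  shows "tm_eval A f t \<in> pts (space A)"
  using assms(3)
  by (induction t) (use met_homD(1)[OF assms(2)] qalg_op_closed[OF assms(1)] in auto)

lemma tm_eval_nonexpanding:
  assumes A: "A \<in> variety \<epsilon>" and f: "f \<in> met_hom X (space A)"
    and "set_tm s \<subseteq> pts X" "set_tm t \<subseteq> pts X"
  shows "dst (space A) (tm_eval A f s) (tm_eval A f t) \<le> tm_dist (ennreal \<epsilon>) (dst X) s t"
  using assms(3,4)
proof (induction s arbitrary: t)
  case (Var x)
  then show ?case using met_homD[OF f] by (cases t) auto
next
  case (App i s1 s2)
  show ?case
  proof (cases t)
    case t: (App j t1 t2)
    let ?D = "dst (space A)" and ?e = "tm_eval A f"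
    let ?o = "\<lambda>i. if i then op1 A else op2 A"
    have q: "is_qalg A" "is_met (space A)" using varietyD A by blast+
    have mem: "?e s1 \<in> pts (space A)" "?e s2 \<in> pts (space A)" "?e t1 \<in> pts (space A)" "?e t2 \<in> pts (space A)"
      using tm_eval_closed[OF q(1) f] App.prems t by auto
    have cl: "?o k a b \<in> pts (space A)" if "a \<in> pts (space A)" "b \<in> pts (space A)" for k a b
      using qalg_op_closed[OF q(1)] that by auto
    have 1: "?D (?o i (?e s1) (?e s2)) (?o j (?e s1) (?e s2)) \<le> (if i = j then 0 else ennreal \<epsilon>)"
    proof -
      have z: "?D x x = 0" "?D x y = ?D y x" if "x \<in> pts (space A)" "y \<in> pts (space A)" for x y
        using q(2) that unfolding is_met_def by blast+
      note c = qalg_op_closed[OF q(1) mem(1,2)]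
      have "?D (op1 A (?e s1) (?e s2)) (op2 A (?e s1) (?e s2)) \<le> ennreal \<epsilon>"
        using A mem by (simp add: variety_def)
      then show ?thesis using z(1)[OF c(1,1)] z(1)[OF c(2,2)] z(2)[OF c] by (cases i; cases j) auto
    qed
    have "?D (?o j (?e s1) (?e s2)) (?o j (?e t1) (?e t2)) \<le> max (?D (?e s1) (?e t1)) (?D (?e s2) (?e t2))"
      using q(1) mem by (auto simp: is_qalg_def nonexpanding_op_def)
    also have "\<dots> \<le> max (tm_dist (ennreal \<epsilon>) (dst X) s1 t1) (tm_dist (ennreal \<epsilon>) (dst X) s2 t2)"
      using App t by (intro max.mono) auto
    finally have 2: "?D (?o j (?e s1) (?e s2)) (?o j (?e t1) (?e t2)) \<le> \<dots>" .
    have "?D (?o i (?e s1) (?e s2)) (?o j (?e t1) (?e t2)) \<le>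
        ?D (?o i (?e s1) (?e s2)) (?o j (?e s1) (?e s2)) + ?D (?o j (?e s1) (?e s2)) (?o j (?e t1) (?e t2))"
      using q(2) cl mem unfolding is_met_def by blast
    also have "\<dots> \<le> tm_dist (ennreal \<epsilon>) (dst X) (App i s1 s2) (App j t1 t2)"
      using add_mono[OF 1 2] by simp
    finally show ?thesis by (simp add: t)
  qed auto
qed

lemma tm_encoding_exists: "\<exists>enc :: 'u::infinite tm \<Rightarrow> 'u. inj enc"
proof -
  have "\<exists>p :: 'u \<times> 'u \<Rightarrow> 'u. bij_betw p (UNIV \<times> UNIV) UNIV"
    using card_of_Times_same_infinite[OF infinite_UNIV] unfolding card_of_ordIso[symmetric] .
  then obtain p :: "'u \<times> 'u \<Rightarrow> 'u" where p: "inj p"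
    by (auto simp: bij_betw_def)
  obtain c :: "nat \<Rightarrow> 'u" where c: "inj c"
    using infinite_countable_subset[of "UNIV :: 'u set"] infinite_UNIV by blast
  define enc :: "'u tm \<Rightarrow> 'u" where
    "enc = rec_tm (\<lambda>x. p (c 0, x)) (\<lambda>i _ _ a b. p (c (if i then 1 else 2), p (a, b)))"
  have e: "enc (Var x) = p (c 0, x)"
    "enc (App i s t) = p (c (if i then 1 else 2), p (enc s, enc t))" for x i s t
    by (simp_all add: enc_def)
  have "enc s = enc t \<Longrightarrow> s = t" for s t
  proof (induction s arbitrary: t)
    case (Var x)
    then show ?case by (cases t) (auto simp: e inj_eq[OF p] inj_eq[OF c] split: if_splits)
  next
    case (App i s1 s2)
    then show ?case by (cases t) (auto simp: e inj_eq[OF p] inj_eq[OF c] split: if_splits)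
  qed
  then show ?thesis by (auto simp: inj_def)
qed

lemma free_algebra_exists:
  fixes X :: "'u::infinite met"
  assumes e: "0 < \<epsilon>" and X: "is_met X"
  shows "\<exists>F \<eta>. free_algebra \<epsilon> X F \<eta>"
proof -
  obtain enc :: "'u tm \<Rightarrow> 'u" where enc: "inj enc" using tm_encoding_exists by blast
  define dec where "dec = inv enc"
  have dec[simp]: "dec (enc t) = t" for t by (simp add: dec_def enc)
  define P where "P = enc ` {t. set_tm t \<subseteq> pts X}"
  define M where "M = \<lparr>pts = P, dst = (\<lambda>a b. tm_dist (ennreal \<epsilon>) (dst X) (dec a) (dec b))\<rparr>"
  define F where "F = \<lparr>space = M, op1 = (\<lambda>a b. enc (App True (dec a) (dec b))),
      op2 = (\<lambda>a b. enc (App False (dec a) (dec b)))\<rparr>"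
  define \<eta> where "\<eta> = (\<lambda>x\<in>pts X. enc (Var x))"
  have e': "ennreal \<epsilon> > 0" using e by simp
  have "is_met M"
    unfolding is_met_def M_def P_def
    using tm_dist_eq_0[OF e' X] tm_dist_sym[OF X] tm_dist_triangle[OF X] inj_eq[OF enc] by auto
  then have F: "F \<in> variety \<epsilon>"
    unfolding variety_def is_qalg_def nonexpanding_op_def
    using tm_dist_eq_0[OF e' X]
    by (auto simp: F_def M_def P_def inj_image_mem_iff[OF enc] ennreal_max_eq_0)
  have eta: "\<eta> \<in> met_hom X (space F)"
    by (rule met_homI) (auto simp: \<eta>_def F_def M_def P_def)
  have "\<exists>!h. h \<in> qalg_hom F A \<and> compose (pts X) h \<eta> = f"
    if A: "A \<in> variety \<epsilon>" and f: "f \<in> met_hom X (space A)" for A f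
  proof (rule ex1I)
    define h where "h = (\<lambda>a\<in>P. tm_eval A f (dec a))"
    have "h \<in> met_hom M (space A)"
      using tm_eval_closed[OF varietyD(1)[OF A] f] tm_eval_nonexpanding[OF A f]
      by (intro met_homI) (auto simp: h_def M_def P_def)
    then have "h \<in> qalg_hom F A"
      by (auto simp: qalg_hom_def F_def M_def h_def P_def inj_image_mem_iff[OF enc])
    moreover have "compose (pts X) h \<eta> = f"
      using met_homD[OF f] by (auto simp: compose_def fun_eq_iff h_def \<eta>_def P_def inj_image_mem_iff[OF enc])
    ultimately show "h \<in> qalg_hom F A \<and> compose (pts X) h \<eta> = f" by blast
    fix k assume k: "k \<in> qalg_hom F A \<and> compose (pts X) k \<eta> = f"
    have ops: "k (enc (App i s t)) = (if i then op1 A else op2 A) (k (enc s)) (k (enc t))"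
      if "set_tm s \<subseteq> pts X" "set_tm t \<subseteq> pts X" for i s t
      using qalg_homD(2,3)[OF conjunct1[OF k], of "enc s" "enc t"] that
      by (auto simp: F_def M_def P_def)
    have vars: "k (enc (Var x)) = f x" if "x \<in> pts X" for x
      using fun_cong[OF conjunct2[OF k], of x] that by (simp add: compose_def \<eta>_def)
    have "k (enc t) = tm_eval A f t" if "set_tm t \<subseteq> pts X" for t
      using that by (induction t) (auto simp: ops vars)
    moreover have "k a = undefined" if "a \<notin> P" for a
      using met_homD(2)[OF qalg_homD(1)[OF conjunct1[OF k]]] that by (simp add: F_def M_def)
    ultimately show "k = h" by (auto simp: fun_eq_iff h_def P_def)
  qed
  then show ?thesis using F eta unfolding free_algebra_def by blast
qed

theorem free_algebra_functor_exists:
  assumes "0 < \<epsilon>"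
  shows "\<exists>T :: ('u::infinite met, 'u) met_functor. free_algebra_functor \<epsilon> T"
proof -
  have "\<forall>X :: 'u met. \<exists>p. is_met X \<longrightarrow> free_algebra \<epsilon> X (fst p) (snd p)"
    using free_algebra_exists[OF assms, where ?'u = 'u] by auto
  then obtain p :: "'u met \<Rightarrow> 'u qalg \<times> ('u \<Rightarrow> 'u)"
    where p: "\<forall>X. is_met X \<longrightarrow> free_algebra \<epsilon> X (fst (p X)) (snd (p X))"
    by (rule choice[THEN exE])
  define F where "F X = fst (p X)" for X
  define \<eta> where "\<eta> X = snd (p X)" for X
  have fr: "free_algebra \<epsilon> X (F X) (\<eta> X)" if "is_met X" for X
    using p that by (simp add: F_def \<eta>_def)
  have "\<exists>h. is_met X \<longrightarrow> is_met Y \<longrightarrow> f \<in> met_hom X Y \<longrightarrow>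
      h \<in> qalg_hom (F X) (F Y) \<and> compose (pts X) h (\<eta> X) = compose (pts X) (\<eta> Y) f" for X Y f
  proof (cases "is_met X \<and> is_met Y \<and> f \<in> met_hom X Y")
    case True
    then have "F Y \<in> variety \<epsilon>" "compose (pts X) (\<eta> Y) f \<in> met_hom X (space (F Y))"
      using fr[of Y] met_hom_compose by (auto simp: free_algebra_def)
    then show ?thesis using True fr[of X] unfolding free_algebra_def by metis
  qed blast
  then obtain h where h: "\<And>X Y f. is_met X \<Longrightarrow> is_met Y \<Longrightarrow> f \<in> met_hom X Y \<Longrightarrow>
      h X Y f \<in> qalg_hom (F X) (F Y) \<and> compose (pts X) (h X Y f) (\<eta> X) = compose (pts X) (\<eta> Y) f"
    by metis
  have "free_algebra_functor \<epsilon> \<lparr>ob = (\<lambda>X. space (F X)), ar = h\<rparr>"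
    unfolding free_algebra_functor_def
    by (rule exI[of _ F], rule exI[of _ \<eta>]) (simp add: fr h)
  then show ?thesis by blast
qed

end

theory Submission
  imports Defs
begin

text \<open>
  Let \<open>X = {a, b}\<close> with \<open>d(a, b) = 1\<close>.  In \<open>T X\<close> the elements \<open>\<sigma>\<^sub>1(a, \<sigma>\<^sub>1(a, a))\<close> and
  \<open>\<sigma>\<^sub>1(b, \<sigma>\<^sub>2(a, a))\<close> have distance at most \<open>max 1 \<epsilon> = 1\<close>.  In the left Kan extension a change of
  variables and a change of operation symbols can only be performed one after the other, so there the
  distance is \<open>1 + \<epsilon>\<close>.  A cocone witnessing this sends \<open>u : A \<rightarrow> X\<close> and \<open>t \<in> T A\<close> to the point
  \<open>u q + p\<close> of the line, where \<open>a, b\<close> are placed at \<open>0, 1\<close>, \<open>q\<close> is the leftmost variable of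
  \<open>t\<close> and \<open>p \<in> {0, \<epsilon>}\<close> records whether \<open>\<sigma>\<^sub>2\<close> occurs on the rightmost branch of \<open>t\<close>.  Both
  \<open>q\<close> and \<open>p\<close> are homomorphisms out of a free algebra, which makes it unnecessary to describe free
  algebras by terms.  As the unit of the Kan extension is arbitrary, one also needs that its
  components are surjective; they are epimorphisms, and the spaces \<open>T A\<close> are uniformly discrete.
\<close>

section \<open>Discrete spaces and the data of a Kan extension\<close>

lemma disc_simps [simp]:
  "pts (disc A) = A" "dst (disc A) x y = (if x = y then 0 else \<infinity>)"
  by (simp_all add: discrete_embedding_def)

lemma is_met_disc: "is_met (disc A)"
  by (auto simp: is_met_def)

lemma met_hom_disc:
  assumes "is_met Y"
  shows "met_hom (disc A) Y = A \<rightarrow>\<^sub>E pts Y"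
  using assms by (auto simp: met_hom_def is_met_def PiE_def Pi_def)

lemma functor_comp_disc_simps [simp]:
  "ob (functor_comp T discrete_embedding) A = ob T (disc A)"
  "ar (functor_comp T discrete_embedding) A B g = ar T (disc A) (disc B) g"
  by (simp_all add: functor_comp_def discrete_embedding_def)

lemma is_met_two_points:
  assumes "c \<noteq> d" "0 < \<delta>"
  shows "is_met \<lparr>pts = {c, d}, dst = (\<lambda>x y. if x = y then 0 else \<delta>)\<rparr>"
  using assms by (auto simp: is_met_def)

lemma dst_hom_space_le:
  "x \<in> pts X \<Longrightarrow> dst Y (f x) (g x) \<le> dst (hom_space X Y) f g"
  by (auto simp: hom_space_def intro: SUP_upper)

lemma setf_nat_transD:
  assumes "setf_nat_trans G H \<eta>"
  shows "finite A \<Longrightarrow> \<eta> A \<in> met_hom (ob G A) (ob H A)"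
    and "finite A \<Longrightarrow> finite B \<Longrightarrow> g \<in> A \<rightarrow>\<^sub>E B \<Longrightarrow> t \<in> pts (ob G A) \<Longrightarrow>
      \<eta> B (ar G A B g t) = ar H A B g (\<eta> A t)"
proof -
  show "finite A \<Longrightarrow> \<eta> A \<in> met_hom (ob G A) (ob H A)"
    using assms by (auto simp: setf_nat_trans_def)
  assume "finite A" "finite B" "g \<in> A \<rightarrow>\<^sub>E B" "t \<in> pts (ob G A)"
  then have "compose (pts (ob G A)) (\<eta> B) (ar G A B g) t = compose (pts (ob G A)) (ar H A B g) (\<eta> A) t"
    using assms unfolding setf_nat_trans_def by metis
  then show "\<eta> B (ar G A B g t) = ar H A B g (\<eta> A t)"
    using \<open>t \<in> _\<close> by (simp add: compose_def)
qed

lemma left_Kan_extD: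
  assumes "left_Kan_ext_along_discrete G L \<eta>"
  shows "setf_nat_trans G (functor_comp L discrete_embedding) \<eta>"
    and "is_met X \<Longrightarrow> is_met Y \<Longrightarrow>
      bij_betw (\<lambda>f. \<lambda>A\<in>Collect finite. \<lambda>u\<in>met_hom (disc A) X.
          compose (pts (ob G A)) f (compose (pts (ob G A)) (ar L (disc A) X u) (\<eta> A)))
        (met_hom (ob L X) Y) (pts (cocone_space G X Y))"
proof -
  show "setf_nat_trans G (functor_comp L discrete_embedding) \<eta>"
    using assms unfolding left_Kan_ext_along_discrete_def by blast
  have pts_hom: "pts (hom_space (ob L X) Y) = met_hom (ob L X) Y"
    by (simp add: hom_space_def)
  show "is_met X \<Longrightarrow> is_met Y \<Longrightarrow>
      bij_betw (\<lambda>f. \<lambda>A\<in>Collect finite. \<lambda>u\<in>met_hom (disc A) X.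
          compose (pts (ob G A)) f (compose (pts (ob G A)) (ar L (disc A) X u) (\<eta> A)))
        (met_hom (ob L X) Y) (pts (cocone_space G X Y))"
    using assms unfolding left_Kan_ext_along_discrete_def isometric_iso_def pts_hom[symmetric] by blast
qed

text \<open>Nonexpanding maps out of \<open>ob T (disc A)\<close> that agree on the range of
  \<open>\<eta> A\<close> induce the same cocone, so the universal property makes them equal.
  Separation by \<open>\<delta>\<close> makes every function into a two-point space of diameter
  \<open>\<delta>\<close> nonexpanding; hence the range can be tested by its own indicator
  function.\<close>

lemma Kan_unit_surj:
  fixes T :: "('u::infinite met, 'u) met_functor"
  assumes T: "enriched_endofunctor T"
    and Kan: "left_Kan_ext_along_discrete (functor_comp T discrete_embedding) T \<eta>"
    and A: "finite A"
    and \<delta>: "0 < \<delta>"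
    and sep: "\<And>s t. s \<in> pts (ob T (disc A)) \<Longrightarrow> t \<in> pts (ob T (disc A)) \<Longrightarrow> s \<noteq> t \<Longrightarrow>
      \<delta> \<le> dst (ob T (disc A)) s t"
  shows "\<eta> A ` pts (ob T (disc A)) = pts (ob T (disc A))"
proof -
  let ?P = "pts (ob T (disc A))"
  obtain c d :: 'u where cd: "c \<noteq> d"
    using ex_new_if_finite[OF infinite_UNIV, of "{undefined}"] by auto
  define Y where "Y = \<lparr>pts = {c, d}, dst = (\<lambda>x y. if x = y then 0 else \<delta>)\<rparr>"
  have Y: "is_met Y" unfolding Y_def using cd \<delta> by (rule is_met_two_points)
  have nt: "setf_nat_trans (functor_comp T discrete_embedding) (functor_comp T discrete_embedding) \<eta>"
    using left_Kan_extD(1)[OF Kan] .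
  note \<eta>A = setf_nat_transD(1)[OF nt A, simplified]
  define \<Phi> where "\<Phi> f = (\<lambda>B\<in>Collect finite. \<lambda>u\<in>met_hom (disc B) (disc A).
      compose (pts (ob T (disc B))) f
        (compose (pts (ob T (disc B))) (ar T (disc B) (disc A) u) (\<eta> B)))" for f :: "'u \<Rightarrow> 'u"
  have inj: "inj_on \<Phi> (met_hom (ob T (disc A)) Y)"
    using left_Kan_extD(2)[OF Kan is_met_disc[of A] Y]
    unfolding \<Phi>_def functor_comp_disc_simps by (rule bij_betw_imp_inj_on)
  define f where "f = (\<lambda>t\<in>?P. c)"
  define g where "g = (\<lambda>t\<in>?P. if t \<in> \<eta> A ` ?P then c else d)"
  have f: "f \<in> met_hom (ob T (disc A)) Y"
    by (rule met_homI) (auto simp: f_def Y_def)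
  have g: "g \<in> met_hom (ob T (disc A)) Y"
    by (rule met_homI) (use sep in \<open>auto simp: g_def Y_def\<close>)
  have "f (ar T (disc B) (disc A) u (\<eta> B t)) = g (ar T (disc B) (disc A) u (\<eta> B t))"
    if B: "finite B" and u: "u \<in> met_hom (disc B) (disc A)" and t: "t \<in> pts (ob T (disc B))" for B u t
  proof -
    have "ar T (disc B) (disc A) u \<in> met_hom (ob T (disc B)) (ob T (disc A))"
      using T u is_met_disc unfolding enriched_endofunctor_def by blast
    note mem = met_homD(1)[OF this t]
    \<comment> \<open>Naturality of the unit places every point seen by the induced cocones in the
      range of \<open>\<eta> A\<close>, where \<open>f\<close> and \<open>g\<close> agree.\<close>
    have "ar T (disc B) (disc A) u (\<eta> B t) = \<eta> A (ar T (disc B) (disc A) u t)"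
      using setf_nat_transD(2)[OF nt B A, of u t] u t by (simp add: met_hom_disc is_met_disc)
    then show ?thesis using mem met_homD(1)[OF \<eta>A mem] by (simp add: f_def g_def)
  qed
  then have "\<Phi> f = \<Phi> g"
    by (auto simp: \<Phi>_def compose_def fun_eq_iff)
  then have "f = g" using inj f g by (auto dest: inj_onD)
  have "t \<in> \<eta> A ` ?P" if "t \<in> ?P" for t
    using fun_cong[OF \<open>f = g\<close>, of t] that cd by (simp add: f_def g_def split: if_splits)
  then show ?thesis using met_homD(1)[OF \<eta>A] by blast
qed

section \<open>Homomorphisms out of free algebras, and separation\<close>

lemma free_algebra_extend:
  assumes "free_algebra \<epsilon> X F \<eta>" "A \<in> variety \<epsilon>" "f \<in> met_hom X (space A)"
  shows "\<exists>h. h \<in> qalg_hom F A \<and> (\<forall>x\<in>pts X. h (\<eta> x) = f x)"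
proof -
  obtain h where "h \<in> qalg_hom F A" "compose (pts X) h \<eta> = f"
    using assms unfolding free_algebra_def by blast
  then show ?thesis by (auto simp: compose_def)
qed

lemma free_algebra_hom_eqI:
  assumes "free_algebra \<epsilon> X F \<eta>" "A \<in> variety \<epsilon>" "h \<in> qalg_hom F A" "k \<in> qalg_hom F A"
    and "\<And>x. x \<in> pts X \<Longrightarrow> h (\<eta> x) = k (\<eta> x)"
  shows "h = k"
  using assms(5) by (intro free_algebra_unique[OF assms(1-4)]) (auto simp: compose_def)

text \<open>
  Raising all nonzero distances of \<open>F\<close> to at least \<open>\<epsilon>\<close> leaves \<open>F\<close> in the variety, so freeness
  makes the identity nonexpanding into the modified algebra.
\<close>

lemma free_algebra_separated:
  assumes fr: "free_algebra \<epsilon> X F \<eta>" and e: "0 < \<epsilon>"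
    and X: "\<And>x y. x \<in> pts X \<Longrightarrow> y \<in> pts X \<Longrightarrow> x \<noteq> y \<Longrightarrow> ennreal \<epsilon> \<le> dst X x y"
    and st: "s \<in> pts (space F)" "t \<in> pts (space F)" "s \<noteq> t"
  shows "ennreal \<epsilon> \<le> dst (space F) s t"
proof -
  define D where "D x y = (if x = y then 0 else max (ennreal \<epsilon>) (dst (space F) x y))" for x y
  define A where "A = F\<lparr>space := \<lparr>pts = pts (space F), dst = D\<rparr>\<rparr>"
  have F: "F \<in> variety \<epsilon>" and \<eta>: "\<eta> \<in> met_hom X (space F)"
    using fr by (auto simp: free_algebra_def)
  have FD_refl: "dst (space F) x x = 0" if "x \<in> pts (space F)" for x
    using varietyD(2)[OF F] that unfolding is_met_def by blast
  have D_sym: "D x y = D y x" if "x \<in> pts (space F)" "y \<in> pts (space F)" for x y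
    using varietyD(2)[OF F] that unfolding is_met_def D_def by metis
  have FD_tri: "dst (space F) x z \<le> dst (space F) x y + dst (space F) y z"
    if "x \<in> pts (space F)" "y \<in> pts (space F)" "z \<in> pts (space F)" for x y z
    using varietyD(2)[OF F] that unfolding is_met_def by blast
  have eD: "ennreal \<epsilon> \<le> D x y" if "x \<noteq> y" for x y
    using that by (simp add: D_def)
  have FleD: "dst (space F) x y \<le> D x y" if "x \<in> pts (space F)" for x y
    using FD_refl that by (auto simp: D_def)
  have Dle: "D x y \<le> b" if "x \<noteq> y \<Longrightarrow> ennreal \<epsilon> \<le> b" "dst (space F) x y \<le> b" for x y b
    using that by (simp add: D_def)
  have "is_met (space A)"
    unfolding is_met_def
  proof (intro conjI ballI)
    fix x y z assume xyz: "x \<in> pts (space A)" "y \<in> pts (space A)" "z \<in> pts (space A)"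
    show "dst (space A) x y = 0 \<longleftrightarrow> x = y"
      using e by (simp add: A_def D_def ennreal_max_eq_0)
    show "dst (space A) x y = dst (space A) y x"
      using D_sym xyz by (simp add: A_def)
    show "dst (space A) x z \<le> dst (space A) x y + dst (space A) y z"
    proof (cases "x = y \<or> y = z")
      case True
      then show ?thesis by (auto simp: A_def D_def)
    next
      case False
      \<comment> \<open>Both terms of the maximum in \<open>D x z\<close> are bounded:
        \<open>ennreal \<epsilon>\<close> by the first summand, as \<open>x\<close> and
        \<open>y\<close> differ, and the old distance by the old triangle inequality.\<close>
      have "D x z \<le> D x y + D y z"
      proof (rule Dle)
        show "ennreal \<epsilon> \<le> D x y + D y z"
          using False eD[of x y] by (simp add: add_increasing2)
        show "dst (space F) x z \<le> D x y + D y z"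
          using xyz FD_tri[of x y z] FleD by (simp add: A_def) (meson add_mono order_trans)
      qed
      then show ?thesis by (simp add: A_def)
    qed
  qed
  moreover have "nonexpanding_op (space A) f" if f: "nonexpanding_op (space F) f" for f
    unfolding nonexpanding_op_def
  proof (intro conjI ballI)
    fix a b c d assume m: "a \<in> pts (space A)" "b \<in> pts (space A)" "c \<in> pts (space A)" "d \<in> pts (space A)"
    have "D (f a b) (f c d) \<le> max (D a c) (D b d)"
    proof (rule Dle)
      assume "f a b \<noteq> f c d"
      \<comment> \<open>Different values force a difference in some argument, and there
        \<open>D\<close> is already at least \<open>ennreal \<epsilon>\<close>.\<close>
      then have "a \<noteq> c \<or> b \<noteq> d" by blast
      then show "ennreal \<epsilon> \<le> max (D a c) (D b d)"
        using eD by (auto simp: le_max_iff_disj)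
    next
      have "dst (space F) (f a b) (f c d) \<le> max (dst (space F) a c) (dst (space F) b d)"
        using f m by (simp add: nonexpanding_op_def A_def)
      also have "\<dots> \<le> max (D a c) (D b d)"
        using m by (intro max.mono FleD) (simp_all add: A_def)
      finally show "dst (space F) (f a b) (f c d) \<le> max (D a c) (D b d)" .
    qed
    then show "dst (space A) (f a b) (f c d) \<le> max (dst (space A) a c) (dst (space A) b d)"
      by (simp add: A_def)
  qed (use f in \<open>simp add: nonexpanding_op_def A_def\<close>)
  \<comment> \<open>The defining bound survives, because small distances are raised only to
    \<open>ennreal \<epsilon>\<close>, which is exactly what the equation allows.\<close>
  ultimately have A: "A \<in> variety \<epsilon>"
    using F by (auto simp: variety_def is_qalg_def A_def D_def)
  have "\<eta> \<in> met_hom X (space A)"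
  proof (rule met_homI)
    fix x y assume "x \<in> pts X" "y \<in> pts X"
    then show "dst (space A) (\<eta> x) (\<eta> y) \<le> dst X x y"
      using X[of x y] met_homD(3)[OF \<eta>, of x y] by (auto simp: A_def intro: Dle)
  qed (use met_homD[OF \<eta>] in \<open>auto simp: A_def\<close>)
  then obtain h where h: "h \<in> qalg_hom F A" "\<forall>x\<in>pts X. h (\<eta> x) = \<eta> x"
    using free_algebra_extend[OF fr A] by blast
  \<comment> \<open>As \<open>D\<close> dominates the old distance, \<open>h\<close> is also an
    endomorphism of \<open>F\<close>. It fixes the generators, so it is the identity, and its
    nonexpansiveness into \<open>A\<close> bounds \<open>D\<close> by the old distance.\<close>
  have hm: "h \<in> met_hom (space F) (space F)"
    using met_homD[OF qalg_homD(1)[OF h(1)]]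
    by (intro met_homI) (auto simp: A_def intro: order_trans[OF FleD])
  then have "h \<in> qalg_hom F F"
    using h(1) by (simp add: qalg_hom_def A_def)
  then have "h = restrict id (pts (space F))"
    using h(2) met_homD(1)[OF \<eta>]
    by (intro free_algebra_hom_eqI[OF fr F _ qalg_hom_id[OF varietyD(1)[OF F]]]) auto
  then have "D s t \<le> dst (space F) s t"
    using met_homD(3)[OF qalg_homD(1)[OF h(1)] st(1,2)] st by (simp add: A_def)
  then show ?thesis using eD[OF st(3)] by (rule order_trans[rotated])
qed

section \<open>Test algebras and coordinate metrics\<close>

definition proj_alg :: "'a met \<Rightarrow> 'a qalg" where
  "proj_alg X = \<lparr>space = X, op1 = (\<lambda>a b. a), op2 = (\<lambda>a b. a)\<rparr>"

lemma proj_alg_variety: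
  assumes "is_met X"
  shows "proj_alg X \<in> variety \<epsilon>"
proof -
  have "dst X x x = 0" if "x \<in> pts X" for x
    using assms that unfolding is_met_def by blast
  then show ?thesis
    using assms by (simp add: variety_def is_qalg_def nonexpanding_op_def proj_alg_def)
qed

text \<open>Every map commutes with projections. Hence the leftmost variable may be followed by any
  relabelling of variables.\<close>

lemma qalg_hom_proj_alg: "qalg_hom (proj_alg X) (proj_alg Y) = met_hom X Y"
  by (auto simp: qalg_hom_def proj_alg_def)

text \<open>With all variables sent to \<open>c\<close>, a term evaluates to \<open>d\<close> iff
  \<sigma>2 occurs on its rightmost branch: \<open>op1\<close> passes on the flag of the right
  argument, \<open>op2\<close> raises it. The operations differ only between \<open>c\<close> and
  \<open>d\<close>, whence the distance \<open>ennreal \<epsilon>\<close>.\<close>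

definition flag_alg :: "real \<Rightarrow> 'a \<Rightarrow> 'a \<Rightarrow> 'a qalg" where
  "flag_alg \<epsilon> c d =
     \<lparr>space = \<lparr>pts = {c, d}, dst = (\<lambda>x y. if x = y then 0 else ennreal \<epsilon>)\<rparr>,
      op1 = (\<lambda>a b. b), op2 = (\<lambda>a b. d)\<rparr>"

lemma flag_alg_variety:
  assumes "c \<noteq> d" "0 < \<epsilon>"
  shows "flag_alg \<epsilon> c d \<in> variety \<epsilon>"
  using is_met_two_points[OF assms(1), of "ennreal \<epsilon>"] assms
  by (auto simp: variety_def is_qalg_def nonexpanding_op_def flag_alg_def)

text \<open>The metric of the real line is pulled back along the coordinate \<open>r\<close>;
  injectivity separates the points.\<close>

lemma is_met_line:
  assumes "inj_on r V"
  shows "is_met \<lparr>pts = V, dst = (\<lambda>x y. ennreal \<bar>r x - r y\<bar>)\<rparr>"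
proof -
  have "ennreal \<bar>r x - r z\<bar> \<le> ennreal \<bar>r x - r y\<bar> + ennreal \<bar>r y - r z\<bar>" for x y z
  proof -
    have "ennreal \<bar>r x - r z\<bar> \<le> ennreal (\<bar>r x - r y\<bar> + \<bar>r y - r z\<bar>)"
      by (rule ennreal_leI) simp
    then show ?thesis by (simp add: ennreal_plus)
  qed
  then show ?thesis
    using assms by (simp add: is_met_def inj_on_eq_iff) (simp add: abs_minus_commute)
qed

text \<open>This codes finitely many real numbers by points of the universe, from which all spaces
  take their points.\<close>

lemma ex_inj_on_infinite_type:
  assumes "finite S"
  shows "\<exists>e :: 'a \<Rightarrow> 'u::infinite. inj_on e S"
proof -
  obtain c :: "nat \<Rightarrow> 'u" where "inj c"
    using infinite_countable_subset[of "UNIV :: 'u set"] infinite_UNIV by blast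
  moreover obtain n and i :: "'a \<Rightarrow> nat" where "inj_on i S"
    using finite_imp_inj_to_nat_seg[OF assms] by blast
  ultimately have "inj_on (c \<circ> i) S"
    by (intro comp_inj_on) (auto intro: inj_on_subset)
  then show ?thesis by blast
qed

theorem proposition7p6:
  fixes \<epsilon> :: real and T :: "('u::infinite met, 'u) met_functor"
  assumes "0 < \<epsilon>" and "\<epsilon> < 1"
    and "free_algebra_functor \<epsilon> T"
  shows "\<not> strongly_finitary T"
proof
  assume "strongly_finitary T"
  then obtain \<eta> where Kan: "left_Kan_ext_along_discrete (functor_comp T discrete_embedding) T \<eta>"
    by (auto simp: strongly_finitary_def)
  note nt = left_Kan_extD(1)[OF Kan]
  note \<eta> = setf_nat_transD(1)[OF nt, simplified]
  note \<eta>_nat = setf_nat_transD(2)[OF nt, simplified]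
  obtain F \<iota> where
      fr: "\<And>X. is_met X \<Longrightarrow> free_algebra \<epsilon> X (F X) (\<iota> X)"
    and obT: "\<And>X. is_met X \<Longrightarrow> ob T X = space (F X)"
    and arT: "\<And>X Y f. is_met X \<Longrightarrow> is_met Y \<Longrightarrow> f \<in> met_hom X Y \<Longrightarrow>
        ar T X Y f \<in> qalg_hom (F X) (F Y)"
    and nat: "\<And>X Y f. is_met X \<Longrightarrow> is_met Y \<Longrightarrow> f \<in> met_hom X Y \<Longrightarrow>
        compose (pts X) (ar T X Y f) (\<iota> X) = compose (pts X) (\<iota> Y) f"
    using assms(3) unfolding free_algebra_functor_def by blast
  have var: "F X \<in> variety \<epsilon>" and \<iota>: "\<iota> X \<in> met_hom X (space (F X))" if "is_met X" for X
    using fr[OF that] by (auto simp: free_algebra_def)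
  have natx: "ar T X Y f (\<iota> X x) = \<iota> Y (f x)"
    if "is_met X" "is_met Y" "f \<in> met_hom X Y" "x \<in> pts X" for X Y f x
    using fun_cong[OF nat[OF that(1-3)], of x] that(4) by (simp add: compose_def)
  let ?TA = "\<lambda>A. pts (ob T (disc A))"

  \<comment> \<open>Spaces of coded real numbers\<close>
  define S where "S = {0, \<epsilon>, 1, 1 + \<epsilon>}"
  obtain e :: "real \<Rightarrow> 'u" where e: "inj_on e S"
    using ex_inj_on_infinite_type[of S] by (auto simp: S_def)
  define r where "r = inv_into S e"
  have r: "r (e v) = v" if "v \<in> S" for v
    using e that by (simp add: r_def)
  have rS: "r (e 0) = 0" "r (e \<epsilon>) = \<epsilon>" "r (e 1) = 1" "r (e (1 + \<epsilon>)) = 1 + \<epsilon>"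
    by (simp_all add: r S_def)
  have e0\<epsilon>: "e 0 \<noteq> e \<epsilon>"
    using rS(1,2) assms(1) by auto
  define X where "X = \<lparr>pts = {e 0, e 1}, dst = (\<lambda>x y. ennreal \<bar>r x - r y\<bar>)\<rparr>"
  \<comment> \<open>\<open>S\<close> consists of all sums of a position in {0, 1} and a flag value
    in {0, \<epsilon>}, so \<open>Y\<close> has room for every value of the cocone.\<close>
  define Y where "Y = \<lparr>pts = e ` S, dst = (\<lambda>x y. ennreal \<bar>r x - r y\<bar>)\<rparr>"
  have X: "is_met X" unfolding X_def by (rule is_met_line) (auto simp: inj_on_def rS)
  have Y: "is_met Y" unfolding Y_def by (rule is_met_line) (auto simp: inj_on_def r)

  \<comment> \<open>Leftmost variable and flag on free algebras over discrete spaces\<close>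
  have "\<exists>h. h \<in> qalg_hom (F (disc A)) (proj_alg (disc A)) \<and> (\<forall>x\<in>A. h (\<iota> (disc A) x) = x)" for A
    using free_algebra_extend[OF fr[OF is_met_disc] proj_alg_variety[OF is_met_disc], of "restrict id A" A A]
      met_hom_id[of "disc A"] by (simp add: proj_alg_def)
  then obtain q where q: "\<And>A. q A \<in> qalg_hom (F (disc A)) (proj_alg (disc A))"
    and q\<iota>: "\<And>A x. x \<in> A \<Longrightarrow> q A (\<iota> (disc A) x) = x" by metis
  define B where "B = flag_alg \<epsilon> (e 0) (e \<epsilon>)"
  have B: "B \<in> variety \<epsilon>" unfolding B_def using e0\<epsilon> assms(1) by (rule flag_alg_variety)
  have "(\<lambda>x\<in>A. e 0) \<in> met_hom (disc A) (space B)" for A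
    by (rule met_homI) (auto simp: B_def flag_alg_def)
  from free_algebra_extend[OF fr[OF is_met_disc] B this]
  have "\<exists>h. h \<in> qalg_hom (F (disc A)) B \<and> (\<forall>x\<in>A. h (\<iota> (disc A) x) = e 0)" for A
    by simp
  then obtain p where p: "\<And>A. p A \<in> qalg_hom (F (disc A)) B"
    and p\<iota>: "\<And>A x. x \<in> A \<Longrightarrow> p A (\<iota> (disc A) x) = e 0" by metis
  note qm = met_homD[OF qalg_homD(1)[OF q]] and pm = met_homD[OF qalg_homD(1)[OF p]]
  have q_in: "q A t \<in> A" and p_in: "p A t \<in> {e 0, e \<epsilon>}" if "t \<in> ?TA A" for A t
    using qm(1) pm(1) that by (auto simp: obT is_met_disc proj_alg_def B_def flag_alg_def)
  have arD: "ar T (disc A) (disc A') g \<in> qalg_hom (F (disc A)) (F (disc A'))"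
    if "g \<in> A \<rightarrow>\<^sub>E A'" for A A' g
    using arT[OF is_met_disc is_met_disc] that by (simp add: met_hom_disc is_met_disc)
  \<comment> \<open>Substituting variables along \<open>g\<close> relabels the leftmost variable and
    leaves the flag alone. In each case two homomorphisms out of a free algebra are compared on
    generators.\<close>
  have q_nat: "q A' (ar T (disc A) (disc A') g t) = g (q A t)"
    and p_nat: "p A' (ar T (disc A) (disc A') g t) = p A t"
    if g: "g \<in> A \<rightarrow>\<^sub>E A'" and t: "t \<in> ?TA A" for A A' g t
  proof -
    let ?C = "compose (pts (space (F (disc A))))" and ?g = "ar T (disc A) (disc A') g"
    note qa = varietyD(1)[OF var[OF is_met_disc[of A]]]
    have gm: "g \<in> met_hom (disc A) (disc A')" using g by (simp add: met_hom_disc is_met_disc)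
    note \<iota>A = met_homD(1)[OF \<iota>[OF is_met_disc[of A]], simplified]
    note nx = natx[OF is_met_disc is_met_disc gm, simplified]
    have "?C (q A') ?g = ?C g (q A)"
    proof (rule free_algebra_hom_eqI[OF fr[OF is_met_disc] proj_alg_variety[OF is_met_disc]])
      show "?C (q A') ?g \<in> qalg_hom (F (disc A)) (proj_alg (disc A'))"
        by (rule qalg_hom_compose[OF qa arD[OF g] q])
      show "?C g (q A) \<in> qalg_hom (F (disc A)) (proj_alg (disc A'))"
        by (rule qalg_hom_compose[OF qa q]) (simp add: qalg_hom_proj_alg gm)
    qed (use PiE_mem[OF g] in \<open>auto simp: compose_def \<iota>A nx q\<iota>\<close>)
    then show "q A' (?g t) = g (q A t)"
      using t by (simp add: obT is_met_disc compose_def fun_eq_iff) metis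
    have "?C (p A') ?g = p A"
      by (rule free_algebra_hom_eqI[OF fr[OF is_met_disc] B qalg_hom_compose[OF qa arD[OF g] p] p])
        (use PiE_mem[OF g] in \<open>auto simp: compose_def \<iota>A nx p\<iota>\<close>)
    then show "p A' (?g t) = p A t"
      using t by (simp add: obT is_met_disc compose_def fun_eq_iff) metis
  qed

  \<comment> \<open>The cocone and its induced map\<close>
  define \<phi> where "\<phi> = (\<lambda>A\<in>Collect finite. \<lambda>u\<in>met_hom (disc A) X. \<lambda>t\<in>?TA A.
      e (r (u (q A (\<eta> A t))) + r (p A (\<eta> A t))))"
  have u_in: "u x \<in> {e 0, e 1}" if "u \<in> met_hom (disc A) X" "x \<in> A" for u A x
    using met_homD(1)[OF that(1)] that(2) by (simp add: X_def)
  have \<eta>_in: "\<eta> A t \<in> ?TA A" if "finite A" "t \<in> ?TA A" for A t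
    using met_homD(1)[OF \<eta>] that by blast
  have \<phi>_val: "r (u (q A (\<eta> A t))) + r (p A (\<eta> A t)) \<in> S"
    if "finite A" "u \<in> met_hom (disc A) X" "t \<in> ?TA A" for A u t
    using u_in[OF that(2) q_in[OF \<eta>_in[OF that(1,3)]]] p_in[OF \<eta>_in[OF that(1,3)]]
    by (auto simp: rS S_def)
  have r\<phi>: "r (\<phi> A u t) = r (u (q A (\<eta> A t))) + r (p A (\<eta> A t))"
    if "finite A" "u \<in> met_hom (disc A) X" "t \<in> ?TA A" for A u t
    using that r[OF \<phi>_val[OF that]] by (simp add: \<phi>_def)
  have \<phi>_hom: "\<phi> A u \<in> met_hom (ob T (disc A)) Y"
    if A: "finite A" and u: "u \<in> met_hom (disc A) X" for A u
  proof (rule met_homI)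
    fix s t assume s: "s \<in> ?TA A" and t: "t \<in> ?TA A"
    note m = \<eta>_in[OF A s] \<eta>_in[OF A t]
    note m' = m[unfolded obT[OF is_met_disc]]
    have le: "dst (space (F (disc A))) (\<eta> A s) (\<eta> A t) \<le> dst (ob T (disc A)) s t"
      using met_homD(3)[OF \<eta>[OF A] s t] by (simp add: obT is_met_disc)
    show "dst Y (\<phi> A u s) (\<phi> A u t) \<le> dst (ob T (disc A)) s t"
    \<comment> \<open>With equal leftmost variables only the flag changes, and \<open>p\<close> is
      nonexpanding. Otherwise \<open>q\<close> maps nonexpandingly to a discrete space, so the
      arguments are infinitely far apart.\<close>
    proof (cases "q A (\<eta> A s) = q A (\<eta> A t)")
      case True
      have "dst Y (\<phi> A u s) (\<phi> A u t) = ennreal \<bar>r (p A (\<eta> A s)) - r (p A (\<eta> A t))\<bar>"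
        using True by (simp add: Y_def r\<phi>[OF A u] s t)
      also have "\<dots> = dst (space B) (p A (\<eta> A s)) (p A (\<eta> A t))"
        using p_in[OF m(1)] p_in[OF m(2)] e0\<epsilon> assms(1) by (auto simp: B_def flag_alg_def rS)
      also have "\<dots> \<le> dst (ob T (disc A)) s t"
        using pm(3)[OF m'] le by (rule order_trans)
      finally show ?thesis .
    next
      case False
      then have "dst (ob T (disc A)) s t = \<infinity>"
        using order_trans[OF qm(3)[OF m'] le] by (simp add: proj_alg_def top_unique)
      then show ?thesis by simp
    qed
  qed (use A u \<phi>_val in \<open>auto simp: \<phi>_def Y_def\<close>)
  have "\<phi> \<in> pts (cocone_space (functor_comp T discrete_embedding) X Y)"
  proof -
    have "\<phi> A \<in> met_hom (hom_space (disc A) X) (hom_space (ob T (disc A)) Y)" if A: "finite A" for A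
    proof (rule met_homI)
      fix u v assume "u \<in> pts (hom_space (disc A) X)" "v \<in> pts (hom_space (disc A) X)"
      then have uv: "u \<in> met_hom (disc A) X" "v \<in> met_hom (disc A) X"
        by (simp_all add: hom_space_def)
      have "dst Y (\<phi> A u t) (\<phi> A v t) \<le> dst (hom_space (disc A) X) u v" if t: "t \<in> ?TA A" for t
      proof -
        \<comment> \<open>For fixed \<open>t\<close> the flag contributes the same summand on both
          sides and cancels.\<close>
        have "dst Y (\<phi> A u t) (\<phi> A v t) = dst X (u (q A (\<eta> A t))) (v (q A (\<eta> A t)))"
          by (simp add: Y_def X_def r\<phi>[OF A uv(1) t] r\<phi>[OF A uv(2) t])
        then show ?thesis
          using dst_hom_space_le[of "q A (\<eta> A t)" "disc A" X u v] q_in[OF \<eta>_in[OF A t]] by simp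
      qed
      then show "dst (hom_space (ob T (disc A)) Y) (\<phi> A u) (\<phi> A v) \<le> dst (hom_space (disc A) X) u v"
        by (subst hom_space_def) (simp add: SUP_least)
    qed (use A \<phi>_hom in \<open>auto simp: hom_space_def \<phi>_def\<close>)
    moreover have "\<phi> A (compose A u g) = compose (?TA A) (\<phi> A' u) (ar T (disc A) (disc A') g)"
      if A: "finite A" "finite A'" and g: "g \<in> A \<rightarrow>\<^sub>E A'" and u: "u \<in> met_hom (disc A') X" for A A' g u
    proof -
      have c: "compose A u g \<in> met_hom (disc A) X"
        using met_hom_compose[of g "disc A" "disc A'" u X] g u by (simp add: met_hom_disc is_met_disc)
      have "ar T (disc A) (disc A') g t \<in> ?TA A'" if "t \<in> ?TA A" for t
        using met_homD(1)[OF qalg_homD(1)[OF arD[OF g]]] that by (simp add: obT is_met_disc)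
      then show ?thesis
        using A u c q_in \<eta>_in q_nat[OF g] p_nat[OF g] \<eta>_nat[OF A g]
        by (auto simp: \<phi>_def fun_eq_iff compose_def)
    qed
    ultimately show ?thesis by (auto simp: cocone_space_def \<phi>_def)
  qed
  \<comment> \<open>Here the surjectivity of the comparison map enters: the cocone comes from a
    nonexpanding map on \<open>ob T X\<close>.\<close>
  then obtain f where f: "f \<in> met_hom (ob T X) Y"
    and \<phi>f: "\<phi> = (\<lambda>A\<in>Collect finite. \<lambda>u\<in>met_hom (disc A) X.
             compose (?TA A) f (compose (?TA A) (ar T (disc A) X u) (\<eta> A)))"
    using left_Kan_extD(2)[OF Kan X Y]
    unfolding functor_comp_disc_simps bij_betw_def by blast

  \<comment> \<open>Evaluating the induced map through the unit\<close>
  define A where "A = {e 0, e 1}"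
  have A: "finite A" and eA: "e 0 \<in> A" "e 1 \<in> A" by (simp_all add: A_def)
  \<comment> \<open>\<open>u\<close> is the identity on points, from the discrete space on the
    points of \<open>X\<close> to \<open>X\<close> itself.\<close>
  define u where "u = restrict id A"
  have u: "u \<in> met_hom (disc A) X" unfolding met_hom_disc[OF X] by (simp add: u_def X_def A_def)
  have ue: "u (e 0) = e 0" "u (e 1) = e 1" using eA by (simp_all add: u_def)
  have surj: "\<eta> A ` ?TA A = ?TA A"
    using free_algebra_functor_enriched[OF assms(3)] Kan A
  proof (rule Kan_unit_surj)
    show "0 < ennreal \<epsilon>" using assms(1) by simp
    show "ennreal \<epsilon> \<le> dst (ob T (disc A)) s t" if "s \<in> ?TA A" "t \<in> ?TA A" "s \<noteq> t" for s t
      using free_algebra_separated[OF fr[OF is_met_disc[of A]] assms(1), of s t] that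
      by (simp add: obT is_met_disc)
  qed
  \<comment> \<open>The cocone was defined through \<open>\<eta> A t\<close>, so writing
    \<open>s\<close> as \<open>\<eta> A t\<close> removes the unknown unit from the formula.\<close>
  have rf: "r (f (ar T (disc A) X u s)) = r (u (q A s)) + r (p A s)" if s: "s \<in> ?TA A" for s
  proof -
    obtain t where t: "t \<in> ?TA A" "s = \<eta> A t" using s surj by blast
    have "\<phi> A u t = f (ar T (disc A) X u s)"
      unfolding \<phi>f using A u t by (simp add: compose_def)
    then show ?thesis using r\<phi>[OF A u t(1)] t(2) by simp
  qed

  \<comment> \<open>The two elements that are too close\<close>
  let ?FA = "F (disc A)" and ?\<iota> = "\<iota> (disc A)"
  define s where "s = op1 ?FA (?\<iota> (e 0)) (op1 ?FA (?\<iota> (e 0)) (?\<iota> (e 0)))"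
  define s' where "s' = op1 ?FA (?\<iota> (e 1)) (op2 ?FA (?\<iota> (e 0)) (?\<iota> (e 0)))"
  have \<iota>A: "?\<iota> (e 0) \<in> pts (space ?FA)" "?\<iota> (e 1) \<in> pts (space ?FA)"
    using met_homD(1)[OF \<iota>[OF is_met_disc[of A]]] eA by simp_all
  note cl = qalg_op_closed[OF varietyD(1)[OF var[OF is_met_disc[of A]]]]
  have ss: "s \<in> ?TA A" "s' \<in> ?TA A"
    by (simp_all add: obT is_met_disc s_def s'_def cl \<iota>A)
  have "q A s = e 0" "q A s' = e 1" "p A s = e 0" "p A s' = e \<epsilon>"
    by (simp_all add: s_def s'_def qalg_homD(2,3)[OF q] qalg_homD(2,3)[OF p] cl \<iota>A q\<iota> p\<iota> eA
        proj_alg_def B_def flag_alg_def)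
  then have rss: "r (f (ar T (disc A) X u s)) = 0" "r (f (ar T (disc A) X u s')) = 1 + \<epsilon>"
    by (simp_all add: rf ss ue rS)
  let ?F = "F X" and ?D = "dst (space (F X))"
  note h = arT[OF is_met_disc X u]
  have hs: "ar T (disc A) X u s = op1 ?F (\<iota> X (e 0)) (op1 ?F (\<iota> X (e 0)) (\<iota> X (e 0)))"
    "ar T (disc A) X u s' = op1 ?F (\<iota> X (e 1)) (op2 ?F (\<iota> X (e 0)) (\<iota> X (e 0)))"
    using natx[OF is_met_disc X u]
    by (simp_all add: s_def s'_def qalg_homD(2,3)[OF h] cl \<iota>A ue eA)
  have \<iota>X: "\<iota> X (e 0) \<in> pts (space ?F)" "\<iota> X (e 1) \<in> pts (space ?F)"
    using met_homD(1)[OF \<iota>[OF X]] by (simp_all add: X_def)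
  note clX = qalg_op_closed[OF varietyD(1)[OF var[OF X]]]
  \<comment> \<open>The maximum metric charges only the larger of the two changes: at most 1 for the
    variable on the left, at most \<epsilon> for the symbol on the right.\<close>
  have "?D (ar T (disc A) X u s) (ar T (disc A) X u s') \<le>
      max (?D (\<iota> X (e 0)) (\<iota> X (e 1)))
        (?D (op1 ?F (\<iota> X (e 0)) (\<iota> X (e 0))) (op2 ?F (\<iota> X (e 0)) (\<iota> X (e 0))))"
    using varietyD(1)[OF var[OF X]] \<iota>X clX unfolding hs is_qalg_def nonexpanding_op_def by blast
  also have "\<dots> \<le> max (dst X (e 0) (e 1)) (ennreal \<epsilon>)"
    using var[OF X] \<iota>X met_homD(3)[OF \<iota>[OF X], of "e 0" "e 1"]
    by (intro max.mono) (simp_all add: variety_def X_def)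
  also have "\<dots> \<le> 1"
    using assms(2) by (simp add: X_def rS)
  finally have D1: "?D (ar T (disc A) X u s) (ar T (disc A) X u s') \<le> 1" .
  \<comment> \<open>The images under \<open>f\<close> have coordinates 0 and 1 + \<epsilon>, so
    nonexpansiveness of \<open>f\<close> would give 1 + \<epsilon> \<le> 1.\<close>
  have "ennreal (1 + \<epsilon>) = dst Y (f (ar T (disc A) X u s)) (f (ar T (disc A) X u s'))"
    using assms(1) by (simp add: Y_def rss)
  also have "\<dots> \<le> ?D (ar T (disc A) X u s) (ar T (disc A) X u s')"
    using met_homD(3)[OF f] met_homD(1)[OF qalg_homD(1)[OF h]] ss by (simp add: obT X is_met_disc)
  also note D1
  finally show False using assms(1) by (simp only: ennreal_le_1)
qed

end
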